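(* Let $\Lambda$ be a non-ordinary numerical semigroup with conductor $c$, multiplicity $m$ and jump $u$, and let $\omega=\omega(\Lambda)$. 1. Let $\sigma$ be an integer with $c\leq \sigma<c+u$ (so that $\sigma\in\Lambda$). Then $\sigma$ is a right generator of $\Lambda$ if and only if one of the following holds: (a) $\sigma\not\equiv 0 \pmod{\omega}$; (b) $\sigma\equiv 0\pmod{\omega}$ and $\frac{\sigma}{\omega}\notin\overline{\Lambda}$. 2. Let $\sigma$ be a right generator of $\Lambda$ in case (a), i.e. $\sigma\not\equiv 0\pmod\omega$. Then $\sigma$ is a strong generator of $\Lambda$ if and only if $\sigma<c+u$. 3. Let $\sigma$ be a right generator of $\Lambda$ in case (b), i.e. $\sigma\equiv 0\pmod\omega$ and $\frac{\sigma}{\omega}\notin\overline{\Lambda}$. Then $\sigma$ is a strong generator of $\Lambda$ if and only if $\frac{\sigma+m}{\omega(\Lambda\setminus\{\sigma\})}\notin\overline{\Lambda\setminus\{\sigma\}}$.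
   Context: A numerical semigroup is a subset $\Lambda\subseteq\mathbb{N}_0$ containing $0$, closed under addition, with finite complement in $\mathbb{N}_0$. The elements of $\mathbb{N}_0\setminus\Lambda$ are the gaps and the largest gap is the Frobenius number. The conductor $c(\Lambda)$ is the least non-gap larger than the Frobenius number (so $c(\Lambda)$ is the Frobenius number plus one). The multiplicity $m(\Lambda)$ is the smallest nonzero element of $\Lambda$. The jump $u(\Lambda)$ is the difference between the second and the first nonzero elements of $\Lambda$. $\Lambda$ is ordinary if its gaps are all consecutive starting from $1$ (i.e. $\Lambda=\{0\}\cup\{n: n\geq m\}$, including $\mathbb{N}_0$). The set of left elements $L(\Lambda)$ is the set of elements of $\Lambda$ smaller than the Frobenius number. Each numerical semigroup has a unique minimal generating set, whose elements are called minimal generators. The right generators are the minimal generators that are not left elements (equivalently, those that are $\geq c(\Lambda)$). If $\sigma$ is a right generator then $\Lambda\setminus\{\sigma\}$ is a numerical semigroup. For non-ordinary $\Lambda$, $\omega(\Lambda)=\gcd(L(\Lambda))$, and the shrinking of $\Lambda$ is the numerical semigroup $\overline{\Lambda}=\left\langle \frac{L(\Lambda)}{\omega(\Lambda)}\right\rangle$ generated by the left elements divided by their gcd; $\overline{\Lambda\setminus\{\sigma\}}$ denotes the shrinking of $\Lambda\setminus\{\sigma\}$. If $\sigma_1<\dots<\sigma_r$ are the right generators of a non-ordinary $\Lambda$ of multiplicity $m$, then the right generators of $\Lambda\setminus\{\sigma_i\}$ are either $\{\sigma_{i+1},\dots,\sigma_r\}$ or $\{\sigma_{i+1},\dots,\sigma_r,\sigma_i+m\}$.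 The generator $\sigma_i$ is called strong in the second case, i.e. if $\sigma_i+m$ is a minimal generator of $\Lambda\setminus\{\sigma_i\}$, and weak otherwise. *)

theory Defs
  imports "HOL.Hull" "HOL-Number_Theory.Cong"
begin

section \<open>Numerical semigroups\<close>

definition add_submonoid :: "nat set \<Rightarrow> bool" where
  "add_submonoid A \<longleftrightarrow> 0 \<in> A \<and> (\<forall>x\<in>A. \<forall>y\<in>A. x + y \<in> A)"

definition numerical_semigroup :: "nat set \<Rightarrow> bool" where
  "numerical_semigroup \<Lambda> \<longleftrightarrow> add_submonoid \<Lambda> \<and> finite (- \<Lambda>)"

definition gaps :: "nat set \<Rightarrow> nat set" where
  "gaps \<Lambda> = - \<Lambda>"

text \<open>The value \<open>-1\<close> when there are no gaps is the usual convention; it makes the conductor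
  one more than the Frobenius number in every case.\<close>

definition frobenius_number :: "nat set \<Rightarrow> int" where
  "frobenius_number \<Lambda> = (if gaps \<Lambda> = {} then -1 else int (Max (gaps \<Lambda>)))"

definition conductor :: "nat set \<Rightarrow> nat" where
  "conductor \<Lambda> = (LEAST n. n \<in> \<Lambda> \<and> frobenius_number \<Lambda> < int n)"

definition ns_multiplicity :: "nat set \<Rightarrow> nat" where
  "ns_multiplicity \<Lambda> = (LEAST n. n \<in> \<Lambda> \<and> n \<noteq> 0)"

definition jump :: "nat set \<Rightarrow> nat" where
  "jump \<Lambda> = (LEAST n. n \<in> \<Lambda> \<and> ns_multiplicity \<Lambda> < n) - ns_multiplicity \<Lambda>"

text \<open>The case \<open>k = 0\<close> is the semigroup of all natural numbers.\<close>

definition ordinary :: "nat set \<Rightarrow> bool" where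
  "ordinary \<Lambda> \<longleftrightarrow> (\<exists>k. gaps \<Lambda> = {1..k})"

definition left_elements :: "nat set \<Rightarrow> nat set" where
  "left_elements \<Lambda> = {x \<in> \<Lambda>. int x < frobenius_number \<Lambda>}"

section \<open>Generators\<close>

definition generated :: "nat set \<Rightarrow> nat set" where
  "generated A = add_submonoid hull A"

definition minimal_generating_set :: "nat set \<Rightarrow> nat set \<Rightarrow> bool" where
  "minimal_generating_set \<Lambda> A \<longleftrightarrow> generated A = \<Lambda> \<and> (\<forall>B. B \<subset> A \<longrightarrow> generated B \<noteq> \<Lambda>)"

text \<open>Existence and uniqueness of the minimal generating set are proved below in
  \<open>ex1_minimal_generating_set\<close>.\<close>

definition minimal_generators :: "nat set \<Rightarrow> nat set" where
  "minimal_generators \<Lambda> = (THE A. minimal_generating_set \<Lambda> A)"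

definition right_generators :: "nat set \<Rightarrow> nat set" where
  "right_generators \<Lambda> = minimal_generators \<Lambda> - left_elements \<Lambda>"

definition strong_generator :: "nat set \<Rightarrow> nat \<Rightarrow> bool" where
  "strong_generator \<Lambda> \<sigma> \<longleftrightarrow>
     \<sigma> \<in> right_generators \<Lambda> \<and> \<sigma> + ns_multiplicity \<Lambda> \<in> minimal_generators (\<Lambda> - {\<sigma>})"

section \<open>The shrinking\<close>

definition omega :: "nat set \<Rightarrow> nat" where
  "omega \<Lambda> = Gcd (left_elements \<Lambda>)"

text \<open>Every division by \<^term>\<open>omega \<Lambda>\<close> here is exact.\<close>

definition shrinking :: "nat set \<Rightarrow> nat set" where
  "shrinking \<Lambda> = generated ((\<lambda>x. x div omega \<Lambda>) ` left_elements \<Lambda>)"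

section \<open>The minimal generating set is well defined\<close>

lemma add_submonoid_generated: "add_submonoid (generated A)"
  unfolding generated_def by (rule hull_in) (auto simp: add_submonoid_def)

lemma subset_generated: "A \<subseteq> generated A"
  unfolding generated_def by (rule hull_subset)

lemma generated_minimal: "A \<subseteq> B \<Longrightarrow> add_submonoid B \<Longrightarrow> generated A \<subseteq> B"
  unfolding generated_def by (rule hull_minimal)

lemma ex1_minimal_generating_set:
  assumes "add_submonoid \<Lambda>"
  shows "\<exists>!A. minimal_generating_set \<Lambda> A"
proof -
  define I where "I = {x \<in> \<Lambda>. x \<noteq> 0 \<and> (\<forall>a\<in>\<Lambda>. \<forall>b\<in>\<Lambda>. x = a + b \<longrightarrow> a = 0 \<or> b = 0)}"
  have "x \<in> generated I" if "x \<in> \<Lambda>" for x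
    using that
  proof (induction x rule: less_induct)
    case (less x)
    show ?case
    proof (cases "x = 0 \<or> x \<in> I")
      case True
      then show ?thesis
        using add_submonoid_generated[of I] subset_generated[of I] by (auto simp: add_submonoid_def)
    next
      case False
      then obtain a b where "a \<in> \<Lambda>" "b \<in> \<Lambda>" "x = a + b" "a \<noteq> 0" "b \<noteq> 0"
        using less.prems by (auto simp: I_def)
      then show ?thesis
        using less.IH[of a] less.IH[of b] add_submonoid_generated[of I]
        by (auto simp: add_submonoid_def)
    qed
  qed
  moreover have "generated I \<subseteq> \<Lambda>"
    by (rule generated_minimal[OF _ assms]) (auto simp: I_def)
  ultimately have gen: "generated I = \<Lambda>" by blast
  have sub: "I \<subseteq> A" if "generated A = \<Lambda>" for A
  proof
    fix x assume x: "x \<in> I"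
    show "x \<in> A"
    proof (rule ccontr)
      assume "x \<notin> A"
      then have "A \<subseteq> \<Lambda> - {x}" using that subset_generated[of A] by blast
      moreover have "add_submonoid (\<Lambda> - {x})"
        using assms x by (fastforce simp: add_submonoid_def I_def)
      ultimately have "\<Lambda> \<subseteq> \<Lambda> - {x}" using generated_minimal that by blast
      then show False using x by (auto simp: I_def)
    qed
  qed
  show ?thesis
  proof (rule ex1I[of _ I])
    show "minimal_generating_set \<Lambda> I"
      using gen sub by (auto simp: minimal_generating_set_def)
    show "A = I" if "minimal_generating_set \<Lambda> A" for A
      using that gen sub[of A] by (auto simp: minimal_generating_set_def)
  qed
qed

end

theory Submission
  imports Defs
begin

text \<open>
  A minimal generator of a submonoid of the natural numbers is a nonzero element that is not a sum
  of two nonzero elements of the submonoid (\<open>minimal_generators_eq\<close>), while divisibility by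
  \<open>\<omega>\<close> together with membership of the quotient in the shrinking means just membership
  in the submonoid generated by the left elements (\<open>mem_generated_left_iff\<close>). So the theorem is
  about the possible decompositions of \<open>\<sigma>\<close> and of \<open>\<sigma> + m\<close>, and each part rests on a size estimate
  that forces the summands to be left elements. The two smallest nonzero elements are \<open>m\<close> and
  \<open>m + u\<close>, and \<open>u \<le> m\<close> because \<open>2 m\<close> is an element.

  Part 1: if \<open>\<sigma> < c + u \<le> c + m\<close> is a sum of two nonzero elements, both are below \<open>c\<close>. Hence
  \<open>\<sigma>\<close> is decomposable iff the left elements generate it.

  Part 2: in \<open>\<Lambda> - {\<sigma>}\<close> the decomposition \<open>\<sigma> + m\<close> itself is no longer available, so the
  summands of any other decomposition are at least \<open>m + u\<close> and hence at most \<open>\<sigma> - u\<close>. If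
  \<open>\<sigma> < c + u\<close>, they are left elements, and \<open>\<omega>\<close> would divide their sum and \<open>m\<close>, hence
  \<open>\<sigma>\<close>. If \<open>\<sigma> \<ge> c + u\<close>, then \<open>(\<sigma> - u) + (m + u)\<close> is a decomposition
  in \<open>\<Lambda> - {\<sigma>}\<close>: the first summand is at least \<open>c\<close>, and the second is not \<open>\<sigma>\<close> because \<open>m < c\<close>.

  Part 3: the same argument shows that all summands of a decomposition of \<open>\<sigma> + m\<close> in
  \<open>\<Lambda> - {\<sigma>}\<close> are below \<open>\<sigma>\<close>, the Frobenius number of \<open>\<Lambda> - {\<sigma>}\<close>. So \<open>\<sigma> + m\<close> is decomposable
  there iff the left elements of \<open>\<Lambda> - {\<sigma>}\<close> generate it.
\<close>

section \<open>Generators and decompositions\<close>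

definition decomposable :: "nat set \<Rightarrow> nat \<Rightarrow> bool" where
  "decomposable A x \<longleftrightarrow> (\<exists>a\<in>A. \<exists>b\<in>A. a \<noteq> 0 \<and> b \<noteq> 0 \<and> x = a + b)"

lemma decomposable_mono: "decomposable A x \<Longrightarrow> A \<subseteq> B \<Longrightarrow> decomposable B x"
  unfolding decomposable_def by blast

lemma generated_add: "x \<in> generated A \<Longrightarrow> y \<in> generated A \<Longrightarrow> x + y \<in> generated A"
  using add_submonoid_generated[of A] by (auto simp: add_submonoid_def)

lemma decomposable_imp_mem_generated: "decomposable A x \<Longrightarrow> x \<in> generated A"
  unfolding decomposable_def using subset_generated[of A] generated_add[of _ A] by blast

text \<open>The elements with one of the three required forms are closed under addition, so they exhaust
  the generated submonoid.\<close>

lemma generated_cases: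
  assumes "x \<in> generated A" "x \<noteq> 0" "x \<notin> A"
  shows "decomposable (generated A) x"
proof -
  define B where "B = {x \<in> generated A. x = 0 \<or> x \<in> A \<or> decomposable (generated A) x}"
  have "0 \<in> B"
    using add_submonoid_generated[of A] by (auto simp: B_def add_submonoid_def)
  moreover have "x + y \<in> B" if "x \<in> B" "y \<in> B" for x y
  proof (cases "x = 0 \<or> y = 0")
    case True
    then show ?thesis using that by auto
  next
    case False
    then have "decomposable (generated A) (x + y)"
      using that by (auto simp: B_def decomposable_def)
    then show ?thesis using that by (simp add: B_def generated_add)
  qed
  ultimately have "add_submonoid B" by (simp add: add_submonoid_def)
  moreover have "A \<subseteq> B" using subset_generated[of A] by (auto simp: B_def)
  ultimately have "generated A \<subseteq> B" by (intro generated_minimal)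
  then show ?thesis using assms by (auto simp: B_def)
qed

text \<open>Splitting an element as long as possible ends in indecomposable elements, so these generate;
  and every generating set contains them, since no sum produces them.\<close>

lemma minimal_generators_eq:
  assumes "add_submonoid \<Lambda>"
  shows "minimal_generators \<Lambda> = {x \<in> \<Lambda>. x \<noteq> 0 \<and> \<not> decomposable \<Lambda> x}" (is "_ = ?I")
proof -
  have "x \<in> generated ?I" if "x \<in> \<Lambda>" for x
    using that
  proof (induction x rule: less_induct)
    case (less x)
    show ?case
    proof (cases "decomposable \<Lambda> x")
      case True
      then obtain a b where "a \<in> \<Lambda>" "b \<in> \<Lambda>" "a \<noteq> 0" "b \<noteq> 0" "x = a + b"
        by (auto simp: decomposable_def)
      then show ?thesis using less.IH[of a] less.IH[of b] by (simp add: generated_add)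
    next
      case False
      then show ?thesis
        using less.prems add_submonoid_generated[of ?I] subset_generated[of ?I]
        by (cases "x = 0") (auto simp: add_submonoid_def)
    qed
  qed
  moreover have "generated ?I \<subseteq> \<Lambda>"
    by (rule generated_minimal[OF _ assms]) auto
  ultimately have gen: "generated ?I = \<Lambda>" by blast
  have "?I \<subseteq> A" if "generated A = \<Lambda>" for A
    using generated_cases[of _ A] that by auto
  then have "minimal_generating_set \<Lambda> ?I"
    using gen by (auto simp: minimal_generating_set_def)
  then show ?thesis
    unfolding minimal_generators_def
    using ex1_minimal_generating_set[OF assms] by (rule the1_equality[rotated])
qed

text \<open>Multiplication by \<open>d\<close> is an injective monoid homomorphism, so it carries the submonoid
  generated by the quotients onto the one generated by \<open>A\<close>.\<close>

lemma generated_div_iff: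
  assumes "d > 0" "\<And>a. a \<in> A \<Longrightarrow> d dvd a"
  shows "n \<in> generated A \<longleftrightarrow> d dvd n \<and> n div d \<in> generated ((\<lambda>x. x div d) ` A)"
proof
  let ?A = "(\<lambda>x. x div d) ` A"
  have "generated A \<subseteq> {n. d dvd n \<and> n div d \<in> generated ?A}"
  proof (rule generated_minimal)
    show "A \<subseteq> {n. d dvd n \<and> n div d \<in> generated ?A}"
      using assms(2) subset_generated[of ?A] by auto
    show "add_submonoid {n. d dvd n \<and> n div d \<in> generated ?A}"
      using add_submonoid_generated[of ?A] by (auto simp: add_submonoid_def)
  qed
  then show "d dvd n \<and> n div d \<in> generated ?A" if "n \<in> generated A" using that by blast
  have "generated ?A \<subseteq> {y. d * y \<in> generated A}"
  proof (rule generated_minimal)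
    show "?A \<subseteq> {y. d * y \<in> generated A}"
      using assms(2) subset_generated[of A] by auto
    show "add_submonoid {y. d * y \<in> generated A}"
      using add_submonoid_generated[of A] by (auto simp: add_submonoid_def distrib_left)
  qed
  then show "n \<in> generated A" if "d dvd n \<and> n div d \<in> generated ?A" using that by force
qed

text \<open>A nonzero left element makes \<open>\<omega>\<close> positive, which the division needs.\<close>

lemma mem_generated_left_iff:
  assumes "x \<in> left_elements \<Lambda>" "x \<noteq> 0"
  shows "n \<in> generated (left_elements \<Lambda>) \<longleftrightarrow> omega \<Lambda> dvd n \<and> n div omega \<Lambda> \<in> shrinking \<Lambda>"
  unfolding shrinking_def
proof (rule generated_div_iff)
  show "omega \<Lambda> > 0" using assms unfolding omega_def by (metis Gcd_0_iff gr0I singletonD subsetD)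
  show "omega \<Lambda> dvd a" if "a \<in> left_elements \<Lambda>" for a
    using that unfolding omega_def by (rule Gcd_dvd)
qed

section \<open>Conductor, multiplicity and jump\<close>

lemma conductor_eq:
  assumes "numerical_semigroup \<Lambda>"
  shows "int (conductor \<Lambda>) = frobenius_number \<Lambda> + 1"
proof -
  have fin: "finite (gaps \<Lambda>)" and z: "0 \<in> \<Lambda>"
    using assms by (auto simp: numerical_semigroup_def gaps_def add_submonoid_def)
  define k where "k = nat (frobenius_number \<Lambda> + 1)"
  have F: "frobenius_number \<Lambda> = int k - 1"
    by (auto simp: k_def frobenius_number_def)
  have "k \<in> \<Lambda>"
  proof (rule ccontr)
    assume "k \<notin> \<Lambda>"
    then have "k \<in> gaps \<Lambda>" by (simp add: gaps_def)
    then have "int k \<le> frobenius_number \<Lambda>"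
      using fin by (auto simp: frobenius_number_def)
    then show False using F by simp
  qed
  then have "conductor \<Lambda> = k"
    unfolding conductor_def F by (intro Least_equality) auto
  then show ?thesis using F by simp
qed

lemma conductor_le_imp_mem:
  assumes "numerical_semigroup \<Lambda>" "conductor \<Lambda> \<le> n"
  shows "n \<in> \<Lambda>"
proof (rule ccontr)
  assume "n \<notin> \<Lambda>"
  then have "n \<in> gaps \<Lambda>" by (simp add: gaps_def)
  then have "int n \<le> frobenius_number \<Lambda>"
    using assms(1) by (auto simp: frobenius_number_def numerical_semigroup_def gaps_def)
  then show False using conductor_eq[OF assms(1)] assms(2) by simp
qed

text \<open>The definition of left elements compares with the Frobenius number, which is a gap; so the
  bound may be raised by one.\<close>

lemma left_elements_eq:
  assumes "numerical_semigroup \<Lambda>"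
  shows "left_elements \<Lambda> = {x \<in> \<Lambda>. x < conductor \<Lambda>}"
proof -
  have "int x \<noteq> frobenius_number \<Lambda>" if "x \<in> \<Lambda>" for x
  proof
    assume x: "int x = frobenius_number \<Lambda>"
    then have "gaps \<Lambda> \<noteq> {}" "x = Max (gaps \<Lambda>)"
      by (auto simp: frobenius_number_def split: if_splits)
    then have "x \<in> gaps \<Lambda>"
      using assms Max_in[of "gaps \<Lambda>"] by (simp add: numerical_semigroup_def gaps_def)
    then show False using that by (simp add: gaps_def)
  qed
  then show ?thesis
    using conductor_eq[OF assms] by (force simp: left_elements_def)
qed

lemma ns_multiplicity_props:
  assumes "numerical_semigroup \<Lambda>"
  shows "ns_multiplicity \<Lambda> \<in> \<Lambda>" "ns_multiplicity \<Lambda> > 0"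
    "\<And>x. x \<in> \<Lambda> \<Longrightarrow> x \<noteq> 0 \<Longrightarrow> ns_multiplicity \<Lambda> \<le> x"
proof -
  have "\<exists>n. n \<in> \<Lambda> \<and> n \<noteq> 0"
    using conductor_le_imp_mem[OF assms, of "Suc (conductor \<Lambda>)"] by auto
  from LeastI_ex[OF this] show "ns_multiplicity \<Lambda> \<in> \<Lambda>" "ns_multiplicity \<Lambda> > 0"
    by (simp_all add: ns_multiplicity_def)
  show "ns_multiplicity \<Lambda> \<le> x" if "x \<in> \<Lambda>" "x \<noteq> 0" for x
    using that unfolding ns_multiplicity_def by (intro Least_le) simp
qed

text \<open>If \<open>c \<le> m\<close>, no nonzero element is below the conductor, so the gaps fill \<open>{1..c - 1}\<close>.\<close>

lemma multiplicity_less_conductor: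
  assumes "numerical_semigroup \<Lambda>" "\<not> ordinary \<Lambda>"
  shows "ns_multiplicity \<Lambda> < conductor \<Lambda>"
proof (rule ccontr)
  assume *: "\<not> ?thesis"
  have "0 \<in> \<Lambda>" using assms(1) by (simp add: numerical_semigroup_def add_submonoid_def)
  have "gaps \<Lambda> = {1..conductor \<Lambda> - 1}"
  proof (intro set_eqI iffI)
    fix x assume "x \<in> gaps \<Lambda>"
    then have "x \<notin> \<Lambda>" by (simp add: gaps_def)
    moreover have "x \<noteq> 0" using \<open>0 \<in> \<Lambda>\<close> \<open>x \<notin> \<Lambda>\<close> by metis
    ultimately show "x \<in> {1..conductor \<Lambda> - 1}"
      using conductor_le_imp_mem[OF assms(1), of x] by force
  next
    fix x assume "x \<in> {1..conductor \<Lambda> - 1}"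
    then have "x \<noteq> 0" "x < ns_multiplicity \<Lambda>" using * by auto
    then show "x \<in> gaps \<Lambda>" using ns_multiplicity_props(3)[OF assms(1), of x]
      by (auto simp: gaps_def)
  qed
  then show False using assms(2) by (auto simp: ordinary_def)
qed

lemma jump_props:
  assumes "numerical_semigroup \<Lambda>"
  shows "ns_multiplicity \<Lambda> + jump \<Lambda> \<in> \<Lambda>" "jump \<Lambda> > 0" "jump \<Lambda> \<le> ns_multiplicity \<Lambda>"
    "\<And>x. x \<in> \<Lambda> \<Longrightarrow> ns_multiplicity \<Lambda> < x \<Longrightarrow> ns_multiplicity \<Lambda> + jump \<Lambda> \<le> x"
proof -
  let ?m = "ns_multiplicity \<Lambda>"
  let ?P = "\<lambda>n. n \<in> \<Lambda> \<and> ?m < n"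
  have "?P (?m + ?m)"
    using assms ns_multiplicity_props[OF assms]
    by (simp add: numerical_semigroup_def add_submonoid_def)
  then have "?P (Least ?P)" "Least ?P \<le> ?m + ?m" by (rule LeastI, rule Least_le)
  then show "?m + jump \<Lambda> \<in> \<Lambda>" "jump \<Lambda> > 0" "jump \<Lambda> \<le> ?m"
    by (simp_all add: jump_def)
  show "?m + jump \<Lambda> \<le> x" if "x \<in> \<Lambda>" "?m < x" for x
    using Least_le[of ?P x] that \<open>?P (Least ?P)\<close> by (simp add: jump_def)
qed

section \<open>Removing a right generator\<close>

lemma right_generators_eq:
  assumes "numerical_semigroup \<Lambda>"
  shows "right_generators \<Lambda> = {x. conductor \<Lambda> \<le> x \<and> x \<noteq> 0 \<and> \<not> decomposable \<Lambda> x}"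
proof -
  have "add_submonoid \<Lambda>" using assms by (simp add: numerical_semigroup_def)
  then show ?thesis
    using conductor_le_imp_mem[OF assms]
    by (auto simp: right_generators_def minimal_generators_eq left_elements_eq[OF assms])
qed

lemma numerical_semigroup_remove:
  assumes "numerical_semigroup \<Lambda>" "\<sigma> \<noteq> 0" "\<not> decomposable \<Lambda> \<sigma>"
  shows "numerical_semigroup (\<Lambda> - {\<sigma>})"
  using assms by (fastforce simp: numerical_semigroup_def add_submonoid_def decomposable_def
      Compl_Diff_eq)

lemma left_elements_remove:
  assumes "numerical_semigroup \<Lambda>" "conductor \<Lambda> \<le> \<sigma>"
  shows "left_elements (\<Lambda> - {\<sigma>}) = {x \<in> \<Lambda>. x < \<sigma>}"
proof -
  have "finite (gaps (\<Lambda> - {\<sigma>}))" "\<sigma> \<in> gaps (\<Lambda> - {\<sigma>})"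
    using assms(1) by (auto simp: numerical_semigroup_def gaps_def Compl_Diff_eq)
  moreover have "x \<le> \<sigma>" if "x \<in> gaps (\<Lambda> - {\<sigma>})" for x
    using conductor_le_imp_mem[OF assms(1), of x] assms(2) that
    by (cases "conductor \<Lambda> \<le> x") (auto simp: gaps_def)
  ultimately have "frobenius_number (\<Lambda> - {\<sigma>}) = int \<sigma>"
    by (auto simp: frobenius_number_def intro!: Max_eqI)
  then show ?thesis by (auto simp: left_elements_def)
qed

text \<open>Without \<open>\<sigma>\<close>, the multiplicity cannot be a summand of \<open>\<sigma> + m\<close>, so both summands are at least
  \<open>m + u\<close>.\<close>

lemma decomposition_avoiding:
  assumes "numerical_semigroup \<Lambda>"
    and "decomposable (\<Lambda> - {\<sigma>}) (\<sigma> + ns_multiplicity \<Lambda>)"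
  obtains a b where "a \<in> \<Lambda>" "b \<in> \<Lambda>" "a \<noteq> 0" "b \<noteq> 0" "\<sigma> + ns_multiplicity \<Lambda> = a + b"
    "a + jump \<Lambda> \<le> \<sigma>" "b + jump \<Lambda> \<le> \<sigma>"
proof -
  let ?m = "ns_multiplicity \<Lambda>"
  obtain a b where ab: "a \<in> \<Lambda> - {\<sigma>}" "b \<in> \<Lambda> - {\<sigma>}" "a \<noteq> 0" "b \<noteq> 0" "\<sigma> + ?m = a + b"
    using assms(2) by (auto simp: decomposable_def)
  then have "?m \<le> a" "?m \<le> b" using ns_multiplicity_props(3)[OF assms(1)] by auto
  moreover have "a \<noteq> ?m" "b \<noteq> ?m" using ab by auto
  ultimately have "?m + jump \<Lambda> \<le> a" "?m + jump \<Lambda> \<le> b"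
    using jump_props(4)[OF assms(1)] ab by auto
  then show ?thesis using ab that[of a b] by auto
qed

lemma strong_generator_iff:
  assumes "numerical_semigroup \<Lambda>" "\<sigma> \<in> right_generators \<Lambda>"
  shows "strong_generator \<Lambda> \<sigma> \<longleftrightarrow> \<not> decomposable (\<Lambda> - {\<sigma>}) (\<sigma> + ns_multiplicity \<Lambda>)"
proof -
  have \<sigma>: "conductor \<Lambda> \<le> \<sigma>" "\<sigma> \<noteq> 0" "\<not> decomposable \<Lambda> \<sigma>"
    using assms by (auto simp: right_generators_eq)
  have "add_submonoid (\<Lambda> - {\<sigma>})"
    using numerical_semigroup_remove[OF assms(1) \<sigma>(2,3)] by (simp add: numerical_semigroup_def)
  moreover have "\<sigma> + ns_multiplicity \<Lambda> \<in> \<Lambda> - {\<sigma>}"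
    using conductor_le_imp_mem[OF assms(1), of "\<sigma> + ns_multiplicity \<Lambda>"]
      ns_multiplicity_props(2)[OF assms(1)] \<sigma>(1) by simp
  ultimately show ?thesis
    using assms(2) \<sigma>(2) by (auto simp: strong_generator_def minimal_generators_eq)
qed

section \<open>The criteria in terms of left elements\<close>

text \<open>Below \<open>c + u \<le> c + m\<close>, a summand of at least \<open>c\<close> would leave less than \<open>m\<close> for the other, so
  every decomposition uses left elements only.\<close>

lemma right_generator_iff:
  assumes "numerical_semigroup \<Lambda>" "\<not> ordinary \<Lambda>"
    and "conductor \<Lambda> \<le> \<sigma>" "\<sigma> < conductor \<Lambda> + jump \<Lambda>"
  shows "\<sigma> \<in> right_generators \<Lambda> \<longleftrightarrow> \<sigma> \<notin> generated (left_elements \<Lambda>)"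
proof -
  note L = left_elements_eq[OF assms(1)]
  have "\<sigma> \<noteq> 0" using multiplicity_less_conductor[OF assms(1,2)] assms(3) by simp
  have "decomposable \<Lambda> \<sigma> \<longleftrightarrow> \<sigma> \<in> generated (left_elements \<Lambda>)"
  proof
    assume "decomposable \<Lambda> \<sigma>"
    then obtain a b where ab: "a \<in> \<Lambda>" "b \<in> \<Lambda>" "a \<noteq> 0" "b \<noteq> 0" "\<sigma> = a + b"
      by (auto simp: decomposable_def)
    have "ns_multiplicity \<Lambda> \<le> a" "ns_multiplicity \<Lambda> \<le> b"
      using ab ns_multiplicity_props(3)[OF assms(1)] by auto
    then have "a < conductor \<Lambda>" "b < conductor \<Lambda>"
      using assms(4) jump_props(3)[OF assms(1)] ab(5) by auto
    then have "decomposable (left_elements \<Lambda>) \<sigma>"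
      using ab by (auto simp: decomposable_def L)
    then show "\<sigma> \<in> generated (left_elements \<Lambda>)" by (rule decomposable_imp_mem_generated)
  next
    assume "\<sigma> \<in> generated (left_elements \<Lambda>)"
    then have "decomposable (generated (left_elements \<Lambda>)) \<sigma>"
      using \<open>\<sigma> \<noteq> 0\<close> assms(3) by (intro generated_cases) (auto simp: L)
    moreover have "generated (left_elements \<Lambda>) \<subseteq> \<Lambda>"
      using assms(1) by (intro generated_minimal) (auto simp: L numerical_semigroup_def)
    ultimately show "decomposable \<Lambda> \<sigma>" by (rule decomposable_mono)
  qed
  then show ?thesis using assms(3) \<open>\<sigma> \<noteq> 0\<close> by (simp add: right_generators_eq[OF assms(1)])
qed

text \<open>By \<open>decomposition_avoiding\<close> the summands of a decomposition of \<open>\<sigma> + m\<close> stay \<open>u\<close> below \<open>\<sigma>\<close>. So \<open>c + u\<close> is the threshold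
  up to which they are left elements, all multiples of \<open>\<omega>\<close>, and from which \<open>\<sigma> - u\<close> is available
  as a summand.\<close>

lemma strong_generator_iff_less:
  assumes "numerical_semigroup \<Lambda>" "\<not> ordinary \<Lambda>"
    and "\<sigma> \<in> right_generators \<Lambda>" "\<not> omega \<Lambda> dvd \<sigma>"
  shows "strong_generator \<Lambda> \<sigma> \<longleftrightarrow> \<sigma> < conductor \<Lambda> + jump \<Lambda>"
proof -
  let ?m = "ns_multiplicity \<Lambda>"
  have m: "?m \<in> \<Lambda>" "?m < conductor \<Lambda>"
    using ns_multiplicity_props(1)[OF assms(1)] multiplicity_less_conductor[OF assms(1,2)] .
  have \<omega>: "omega \<Lambda> dvd x" if "x \<in> \<Lambda>" "x < conductor \<Lambda>" for x
    unfolding omega_def using that by (intro Gcd_dvd) (simp add: left_elements_eq[OF assms(1)])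
  have "decomposable (\<Lambda> - {\<sigma>}) (\<sigma> + ?m) \<longleftrightarrow> conductor \<Lambda> + jump \<Lambda> \<le> \<sigma>"
  proof
    assume "decomposable (\<Lambda> - {\<sigma>}) (\<sigma> + ?m)"
    from decomposition_avoiding[OF assms(1) this] obtain a b
      where ab: "a \<in> \<Lambda>" "b \<in> \<Lambda>" "\<sigma> + ?m = a + b" "a + jump \<Lambda> \<le> \<sigma>" "b + jump \<Lambda> \<le> \<sigma>"
      by metis
    show "conductor \<Lambda> + jump \<Lambda> \<le> \<sigma>"
    proof (rule ccontr)
      assume "\<not> ?thesis"
      then have "omega \<Lambda> dvd a + b" using ab by (intro dvd_add \<omega>) auto
      then show False using assms(4) \<omega>[OF m] ab(3) by (metis dvd_add_left_iff)
    qed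
  next
    assume le: "conductor \<Lambda> + jump \<Lambda> \<le> \<sigma>"
    note u = jump_props(1,2)[OF assms(1)]
    have "\<sigma> - jump \<Lambda> \<in> \<Lambda> - {\<sigma>}"
      using le u(2) conductor_le_imp_mem[OF assms(1), of "\<sigma> - jump \<Lambda>"] by auto
    moreover have "?m + jump \<Lambda> \<in> \<Lambda> - {\<sigma>}" using u le m by auto
    moreover have "\<sigma> + ?m = (\<sigma> - jump \<Lambda>) + (?m + jump \<Lambda>)" "\<sigma> - jump \<Lambda> \<noteq> 0" using le m by auto
    ultimately show "decomposable (\<Lambda> - {\<sigma>}) (\<sigma> + ?m)"
      unfolding decomposable_def using u(2) by (metis add_is_0 less_numeral_extra(3))
  qed
  then show ?thesis using strong_generator_iff[OF assms(1,3)] by auto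
qed

text \<open>Here \<open>\<sigma>\<close> is the Frobenius number of \<open>\<Lambda> - {\<sigma>}\<close>, and both summands of a decomposition of
  \<open>\<sigma> + m\<close> are below it, whatever the size of \<open>\<sigma>\<close>.\<close>

lemma strong_generator_iff_not_generated:
  assumes "numerical_semigroup \<Lambda>" "\<sigma> \<in> right_generators \<Lambda>"
  shows "strong_generator \<Lambda> \<sigma> \<longleftrightarrow>
    \<sigma> + ns_multiplicity \<Lambda> \<notin> generated (left_elements (\<Lambda> - {\<sigma>}))"
proof -
  let ?m = "ns_multiplicity \<Lambda>" and ?L = "left_elements (\<Lambda> - {\<sigma>})"
  have \<sigma>: "conductor \<Lambda> \<le> \<sigma>" "\<sigma> \<noteq> 0" "\<not> decomposable \<Lambda> \<sigma>"
    using assms by (auto simp: right_generators_eq)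
  note L = left_elements_remove[OF assms(1) \<sigma>(1)]
  have "decomposable (\<Lambda> - {\<sigma>}) (\<sigma> + ?m) \<longleftrightarrow> \<sigma> + ?m \<in> generated ?L"
  proof
    assume "decomposable (\<Lambda> - {\<sigma>}) (\<sigma> + ?m)"
    from decomposition_avoiding[OF assms(1) this] obtain a b
      where ab: "a \<in> \<Lambda>" "b \<in> \<Lambda>" "a \<noteq> 0" "b \<noteq> 0" "\<sigma> + ?m = a + b"
        "a + jump \<Lambda> \<le> \<sigma>" "b + jump \<Lambda> \<le> \<sigma>" .
    then have "decomposable ?L (\<sigma> + ?m)"
      using jump_props(2)[OF assms(1)] unfolding decomposable_def L
      by (intro bexI[of _ a] bexI[of _ b]) auto
    then show "\<sigma> + ?m \<in> generated ?L" by (rule decomposable_imp_mem_generated)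
  next
    assume "\<sigma> + ?m \<in> generated ?L"
    then have "decomposable (generated ?L) (\<sigma> + ?m)"
      using \<sigma>(2) by (intro generated_cases) (auto simp: L)
    moreover have "generated ?L \<subseteq> \<Lambda> - {\<sigma>}"
      using numerical_semigroup_remove[OF assms(1) \<sigma>(2,3)]
      by (intro generated_minimal) (auto simp: L numerical_semigroup_def)
    ultimately show "decomposable (\<Lambda> - {\<sigma>}) (\<sigma> + ?m)" by (rule decomposable_mono)
  qed
  then show ?thesis using strong_generator_iff[OF assms] by simp
qed

theorem lemma3p1:
  fixes \<Lambda> :: "nat set"
  assumes "numerical_semigroup \<Lambda>" and "\<not> ordinary \<Lambda>"
  shows
    "(\<forall>\<sigma>. conductor \<Lambda> \<le> \<sigma> \<and> \<sigma> < conductor \<Lambda> + jump \<Lambda> \<longrightarrow>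
        (\<sigma> \<in> right_generators \<Lambda> \<longleftrightarrow>
           \<not> [\<sigma> = 0] (mod omega \<Lambda>) \<or>
           ([\<sigma> = 0] (mod omega \<Lambda>) \<and> \<sigma> div omega \<Lambda> \<notin> shrinking \<Lambda>)))
   \<and> (\<forall>\<sigma>. \<sigma> \<in> right_generators \<Lambda> \<and> \<not> [\<sigma> = 0] (mod omega \<Lambda>) \<longrightarrow>
        (strong_generator \<Lambda> \<sigma> \<longleftrightarrow> \<sigma> < conductor \<Lambda> + jump \<Lambda>))
   \<and> (\<forall>\<sigma>. \<sigma> \<in> right_generators \<Lambda> \<and>
          [\<sigma> = 0] (mod omega \<Lambda>) \<and> \<sigma> div omega \<Lambda> \<notin> shrinking \<Lambda> \<longrightarrow>
        (strong_generator \<Lambda> \<sigma> \<longleftrightarrow>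
           (\<sigma> + ns_multiplicity \<Lambda>) div omega (\<Lambda> - {\<sigma>}) \<notin> shrinking (\<Lambda> - {\<sigma>})))"
proof (intro conjI allI impI; (elim conjE)?)
  let ?m = "ns_multiplicity \<Lambda>"
  have m: "?m \<in> \<Lambda>" "?m \<noteq> 0" "?m < conductor \<Lambda>"
    using ns_multiplicity_props[OF assms(1)] multiplicity_less_conductor[OF assms] by auto
  then have mL: "?m \<in> left_elements \<Lambda>" by (simp add: left_elements_eq[OF assms(1)])
  fix \<sigma>
  show "\<sigma> \<in> right_generators \<Lambda> \<longleftrightarrow>
      \<not> [\<sigma> = 0] (mod omega \<Lambda>) \<or>
      ([\<sigma> = 0] (mod omega \<Lambda>) \<and> \<sigma> div omega \<Lambda> \<notin> shrinking \<Lambda>)"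
    if "conductor \<Lambda> \<le> \<sigma>" "\<sigma> < conductor \<Lambda> + jump \<Lambda>"
    using right_generator_iff[OF assms that] mem_generated_left_iff[OF mL m(2)]
    by (auto simp: cong_0_iff)
  show "strong_generator \<Lambda> \<sigma> \<longleftrightarrow> \<sigma> < conductor \<Lambda> + jump \<Lambda>"
    if "\<sigma> \<in> right_generators \<Lambda>" "\<not> [\<sigma> = 0] (mod omega \<Lambda>)"
    using strong_generator_iff_less[OF assms that(1)] that(2) by (simp add: cong_0_iff)
  show "strong_generator \<Lambda> \<sigma> \<longleftrightarrow>
      (\<sigma> + ?m) div omega (\<Lambda> - {\<sigma>}) \<notin> shrinking (\<Lambda> - {\<sigma>})"
    if \<sigma>: "\<sigma> \<in> right_generators \<Lambda>" "[\<sigma> = 0] (mod omega \<Lambda>)"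
  proof -
    have c: "conductor \<Lambda> \<le> \<sigma>" using \<sigma>(1) by (simp add: right_generators_eq[OF assms(1)])
    then have sub: "left_elements \<Lambda> \<subseteq> left_elements (\<Lambda> - {\<sigma>})"
      by (auto simp: left_elements_eq[OF assms(1)] left_elements_remove[OF assms(1)])
    \<comment> \<open>More left elements have a smaller gcd, so the new \<open>\<omega>\<close> divides the old one, hence \<open>\<sigma>\<close> and \<open>m\<close>.\<close>
    have "omega (\<Lambda> - {\<sigma>}) dvd omega \<Lambda>"
      unfolding omega_def using sub by (intro Gcd_greatest Gcd_dvd) auto
    moreover have "omega \<Lambda> dvd \<sigma> + ?m"
      using \<sigma>(2) Gcd_dvd[OF mL] by (simp add: cong_0_iff omega_def)
    ultimately have "omega (\<Lambda> - {\<sigma>}) dvd \<sigma> + ?m" by (rule dvd_trans)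
    then show ?thesis
      using strong_generator_iff_not_generated[OF assms(1) \<sigma>(1)]
        mem_generated_left_iff[OF subsetD[OF sub mL] m(2)] by simp
  qed
qed

end
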